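(* Let $X$ be a non-empty compact convex subset of a Hausdorff topological vector space. Let $f,g:X\times X\to\mathbb{R}$ be two functions such that (i) for all $x,y\in X$, $f(x,y)\leq g(x,y)$; (ii) for each $y\in X$, the function $f(\cdot,y)$ is lower semicontinuous; (iii) for each $x\in X$, the function $g(x,\cdot)$ is quasi-concave; (iv) for all $x\in X$, $g(x,x)\leq 0$. Then there exists $x_0\in X$ such that $f(x_0,y)\leq 0$ for all $y\in X$.
   Context: Vector spaces are real. A function $h:X\to\mathbb{R}$ on a convex set $X$ is quasi-concave if $\{x\in X: h(x)\geq\lambda\}$ is convex for every $\lambda\in\mathbb{R}$. *)

theory Defs
  imports "HOL-Analysis.Analysis"
begin

text \<open>Real topological vector spaces, not assumed Hausdorff. The continuity condition for scalar
  multiplication is the analogue of the library's one for addition in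
  \<^class>\<open>topological_monoid_add\<close>.\<close>

class real_topological_vector_space = real_vector + topological_ab_group_add +
  assumes tendsto_scaleR_Pair:
    "LIM p (nhds c \<times>\<^sub>F nhds x). fst p *\<^sub>R snd p :> nhds (c *\<^sub>R x)"

instance real_normed_vector \<subseteq> real_topological_vector_space
proof
  fix c :: real and x :: 'a
  have "(fst \<longlongrightarrow> c) (nhds c \<times>\<^sub>F nhds x)" "(snd \<longlongrightarrow> x) (nhds c \<times>\<^sub>F nhds x)"
    by (rule filterlim_fst, rule filterlim_snd)
  then show "LIM p (nhds c \<times>\<^sub>F nhds x). fst p *\<^sub>R snd p :> nhds (c *\<^sub>R x)"
    by (rule tendsto_scaleR)
qed

text \<open>Lower semicontinuity with respect to the subspace topology of \<open>X\<close>.\<close>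

definition lower_semicontinuous_on :: "'a::topological_space set \<Rightarrow> ('a \<Rightarrow> real) \<Rightarrow> bool"
  where "lower_semicontinuous_on X h \<longleftrightarrow>
    (\<forall>c. openin (top_of_set X) {x \<in> X. c < h x})"

definition quasi_concave_on :: "'a::real_vector set \<Rightarrow> ('a \<Rightarrow> real) \<Rightarrow> bool"
  where "quasi_concave_on X h \<longleftrightarrow> (\<forall>c. convex {x \<in> X. c \<le> h x})"

end

theory Submission
  imports Defs
begin

text \<open>Suppose that no \<open>x0\<close> works. By lower semicontinuity the sets
  \<open>{x \<in> X. 0 < f x y}\<close> are then an open cover of \<open>X\<close>, and by compactness finitely many points
  \<open>y 0, \<dots>, y (n - 1)\<close> suffice. The lemma \<open>convex_combination_in_cover\<close>, a form of the theorem of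
  Knaster, Kuratowski and Mazurkiewicz, provides a convex combination \<open>x\<close> of the \<open>y i\<close> such that
  \<open>0 < f x (y i)\<close> for each \<open>i\<close> that has positive weight. Then \<open>g x (y i)\<close> is at least some \<open>c > 0\<close>
  for these \<open>i\<close>, and quasi-concavity of \<open>g x\<close> carries this bound over to their convex combination
  \<open>x\<close> itself: \<open>g x x \<ge> c > 0\<close>, a contradiction.

  The convex combination is a fixed point. A weight vector determines a point of \<open>X\<close>; a
  partition of unity subordinate to the cover, evaluated at this point, gives a new weight vector,
  and the weight vectors that reproduce themselves are those that are wanted. Here the number of
  points is an arbitrary \<open>n\<close>, hence Brouwer's theorem is needed in a dimension that is a number and
  not a type. It is derived from Kuhn's combinatorial lemma in \<open>unit_cube_fixed_point\<close>, with points
  as functions on \<^typ>\<open>nat\<close> of which only the first \<open>n\<close> values matter. Since these points live in the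
  Hilbert cube, compactness is Tychonoff's theorem.\<close>

section \<open>Brouwer's theorem for cubes of numerical dimension\<close>

definition unit_cube :: "(nat \<Rightarrow> real) set"
  where "unit_cube = {t. \<forall>i. t i \<in> {0..1}}"

lemma compact_unit_cube: "compact unit_cube"
proof -
  have "compactin (product_topology (\<lambda>i. euclidean) UNIV) (PiE UNIV (\<lambda>i::nat. {0..1::real}))"
    by (subst compactin_PiE) auto
  moreover have "PiE UNIV (\<lambda>i::nat. {0..1::real}) = unit_cube"
    by (auto simp: unit_cube_def PiE_UNIV_domain)
  ultimately show ?thesis
    by (simp add: euclidean_product_topology)
qed

lemma continuous_on_coordinate: "continuous_on S (\<lambda>t. (t :: nat \<Rightarrow> real) i)"
  by (rule continuous_on_subset[OF continuous_on_product_coordinates]) auto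

lemma fun_tendstoI:
  fixes u :: "nat \<Rightarrow> nat \<Rightarrow> real"
  assumes "\<And>i. (\<lambda>k. u k i) \<longlonglongrightarrow> t i"
  shows "u \<longlonglongrightarrow> t"
  using assms limitin_componentwise[of "\<lambda>_. euclidean" UNIV u t sequentially]
  by (simp add: euclidean_product_topology)

lemma fun_tendstoD:
  fixes u :: "nat \<Rightarrow> nat \<Rightarrow> real"
  assumes "u \<longlonglongrightarrow> t"
  shows "(\<lambda>k. u k i) \<longlonglongrightarrow> t i"
  using assms limitin_componentwise[of "\<lambda>_. euclidean" UNIV u t sequentially]
  by (simp add: euclidean_product_topology)

text \<open>On the grid of mesh \<open>1 / p\<close>, label a point in direction \<open>i\<close> by \<open>0\<close> if the map does not
  decrease its \<open>i\<close>-th coordinate, and by \<open>1\<close> otherwise. Where this coordinate is already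
  maximal the label has to be \<open>1\<close>, which is harmless since the map cannot increase it there. In Kuhn's lemma the two witnesses of
  differing labels carry opposite inequalities. The witnesses depend on the direction, but they all
  lie in one small cube.\<close>

lemma approximate_fixed_point:
  fixes \<phi> :: "nat \<Rightarrow> (nat \<Rightarrow> real) \<Rightarrow> real"
  assumes range: "\<And>i t. i < n \<Longrightarrow> t \<in> unit_cube \<Longrightarrow> \<phi> i t \<in> {0..1}" and "0 < p"
  shows "\<exists>u\<in>unit_cube. \<forall>i<n. \<exists>a\<in>unit_cube. \<exists>b\<in>unit_cube.
    (\<forall>j. \<bar>a j - u j\<bar> \<le> 1 / real p) \<and> (\<forall>j. \<bar>b j - u j\<bar> \<le> 1 / real p) \<and>
    a i \<le> \<phi> i a \<and> \<phi> i b \<le> b i"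
proof -
  define pt where "pt x = (\<lambda>i. if i < n then real (x i) / real p else 0)" for x
  define label where
    "label x i = (if x i < p \<and> pt x i \<le> \<phi> i (pt x) then 0 else 1 :: nat)" for x i
  have pt_cube: "pt x \<in> unit_cube" if "\<forall>i<n. x i \<le> p" for x
    using that \<open>0 < p\<close> by (auto simp: unit_cube_def pt_def)
  have label_0: "label x i = 0" if "\<forall>i<n. x i \<le> p" "i < n" "x i = 0" for x i
    using range[OF \<open>i < n\<close> pt_cube] that \<open>0 < p\<close> by (auto simp: label_def pt_def)
  obtain q where q: "\<forall>i<n. q i < p"
    and label_q: "\<forall>i<n. \<exists>r s. (\<forall>j<n. q j \<le> r j \<and> r j \<le> q j + 1) \<and>
      (\<forall>j<n. q j \<le> s j \<and> s j \<le> q j + 1) \<and> label r i \<noteq> label s i"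
    by (rule kuhn_lemma[OF \<open>0 < p\<close>, of n label]) (use label_0 in \<open>auto simp: label_def\<close>)
  have near: "pt r \<in> unit_cube \<and> (\<forall>j. \<bar>pt r j - pt q j\<bar> \<le> 1 / real p)"
    if r: "\<forall>j<n. q j \<le> r j \<and> r j \<le> q j + 1" for r
  proof
    have "\<forall>j<n. r j \<le> p"
      using q r by (metis Suc_eq_plus1 Suc_leI le_trans)
    then show "pt r \<in> unit_cube"
      by (rule pt_cube)
    show "\<forall>j. \<bar>pt r j - pt q j\<bar> \<le> 1 / real p"
    proof
      fix j
      show "\<bar>pt r j - pt q j\<bar> \<le> 1 / real p"
      proof (cases "j < n")
        case True
        then have "real (q j) \<le> real (r j)" "real (r j) \<le> real (q j) + 1"
          using r by (force, metis of_nat_1 of_nat_add of_nat_mono)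
        then have "\<bar>real (r j) - real (q j)\<bar> \<le> 1"
          by simp
        then show ?thesis
          using True by (simp add: pt_def divide_right_mono flip: diff_divide_distrib)
      qed (simp add: pt_def)
    qed
  qed
  show ?thesis
  proof (rule bexI[of _ "pt q"], intro allI impI)
    show "pt q \<in> unit_cube"
      using q by (auto intro!: pt_cube)
    fix i assume "i < n"
    \<comment> \<open>The two witnesses are interchangeable, so the one with label \<open>0\<close> may be taken first.\<close>
    obtain r s where r: "\<forall>j<n. q j \<le> r j \<and> r j \<le> q j + 1"
      and s: "\<forall>j<n. q j \<le> s j \<and> s j \<le> q j + 1" and "label r i = 0" "label s i = 1"
      using label_q \<open>i < n\<close> by (metis label_def)
    have "pt r i \<le> \<phi> i (pt r)"
      using \<open>label r i = 0\<close> by (auto simp: label_def split: if_splits)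
    moreover have "\<phi> i (pt s) \<le> pt s i"
    proof (cases "s i < p")
      case True
      then show ?thesis
        using \<open>label s i = 1\<close> by (auto simp: label_def split: if_splits)
    next
      case False
      then have "1 \<le> pt s i"
        using \<open>i < n\<close> \<open>0 < p\<close> by (simp add: pt_def)
      then show ?thesis
        using range[OF \<open>i < n\<close>, of "pt s"] near[OF s] by auto
    qed
    ultimately show "\<exists>a\<in>unit_cube. \<exists>b\<in>unit_cube.
        (\<forall>j. \<bar>a j - pt q j\<bar> \<le> 1 / real p) \<and> (\<forall>j. \<bar>b j - pt q j\<bar> \<le> 1 / real p) \<and>
        a i \<le> \<phi> i a \<and> \<phi> i b \<le> b i"
      using near[OF r] near[OF s] by blast
  qed
qed

text \<open>A limit point of the small cubes as the mesh tends to \<open>0\<close> satisfies, in each direction, both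
  of the opposite inequalities.\<close>

theorem unit_cube_fixed_point:
  fixes \<phi> :: "nat \<Rightarrow> (nat \<Rightarrow> real) \<Rightarrow> real"
  assumes cont: "\<And>i. i < n \<Longrightarrow> continuous_on unit_cube (\<phi> i)"
    and range: "\<And>i t. i < n \<Longrightarrow> t \<in> unit_cube \<Longrightarrow> \<phi> i t \<in> {0..1}"
  shows "\<exists>t\<in>unit_cube. \<forall>i<n. \<phi> i t = t i"
proof -
  have "\<forall>k. \<exists>u\<in>unit_cube. \<forall>i<n. \<exists>a\<in>unit_cube. \<exists>b\<in>unit_cube.
    (\<forall>j. \<bar>a j - u j\<bar> \<le> 1 / real (Suc k)) \<and> (\<forall>j. \<bar>b j - u j\<bar> \<le> 1 / real (Suc k)) \<and>
    a i \<le> \<phi> i a \<and> \<phi> i b \<le> b i"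
    using approximate_fixed_point[where n = n and \<phi> = \<phi>] range by blast
  then obtain u where u: "\<And>k. u k \<in> unit_cube"
    and u_near: "\<And>k i. i < n \<Longrightarrow> \<exists>a\<in>unit_cube. \<exists>b\<in>unit_cube.
    (\<forall>j. \<bar>a j - u k j\<bar> \<le> 1 / real (Suc k)) \<and> (\<forall>j. \<bar>b j - u k j\<bar> \<le> 1 / real (Suc k)) \<and>
    a i \<le> \<phi> i a \<and> \<phi> i b \<le> b i"
    by metis
  obtain t \<sigma> where t: "t \<in> unit_cube" and "strict_mono \<sigma>" and lim: "(u \<circ> \<sigma>) \<longlonglongrightarrow> t"
    using compact_unit_cube u unfolding compact_def by metis
  have mesh: "(\<lambda>k. 1 / real (Suc (\<sigma> k))) \<longlonglongrightarrow> 0"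
    using LIMSEQ_subseq_LIMSEQ[OF LIMSEQ_inverse_real_of_nat \<open>strict_mono \<sigma>\<close>]
    by (simp add: o_def inverse_eq_divide)
  have lim_near: "v \<longlonglongrightarrow> t"
    if near: "\<And>k j. \<bar>v k j - u (\<sigma> k) j\<bar> \<le> 1 / real (Suc (\<sigma> k))" for v
  proof (rule fun_tendstoI)
    fix j
    have "(\<lambda>k. v k j - u (\<sigma> k) j) \<longlonglongrightarrow> 0"
      by (rule Lim_null_comparison[OF _ mesh]) (use near in auto)
    then show "(\<lambda>k. v k j) \<longlonglongrightarrow> t j"
      using tendsto_add[OF _ fun_tendstoD[OF lim, of j]] by fastforce
  qed
  have "\<phi> i t = t i" if "i < n" for i
  proof -
    obtain a b where ab: "\<And>k. a k \<in> unit_cube" "\<And>k. b k \<in> unit_cube"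
      and near: "\<And>k j. \<bar>a k j - u (\<sigma> k) j\<bar> \<le> 1 / real (Suc (\<sigma> k))"
        "\<And>k j. \<bar>b k j - u (\<sigma> k) j\<bar> \<le> 1 / real (Suc (\<sigma> k))"
      and ineq: "\<And>k. a k i \<le> \<phi> i (a k)" "\<And>k. \<phi> i (b k) \<le> b k i"
    proof -
      have "\<forall>k. \<exists>a b. a \<in> unit_cube \<and> b \<in> unit_cube \<and>
        (\<forall>j. \<bar>a j - u (\<sigma> k) j\<bar> \<le> 1 / real (Suc (\<sigma> k))) \<and>
        (\<forall>j. \<bar>b j - u (\<sigma> k) j\<bar> \<le> 1 / real (Suc (\<sigma> k))) \<and> a i \<le> \<phi> i a \<and> \<phi> i b \<le> b i"
        using u_near[OF \<open>i < n\<close>] by blast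
      then show thesis
        unfolding choice_iff using that by blast
    qed
    have lim_\<phi>: "(\<lambda>k. \<phi> i (v k)) \<longlonglongrightarrow> \<phi> i t" if "v \<longlonglongrightarrow> t" "\<And>k. v k \<in> unit_cube" for v
      by (rule continuous_on_tendsto_compose[OF cont[OF \<open>i < n\<close>] that(1) t]) (simp add: that(2))
    note a_lim = lim_near[of a, OF near(1)] and b_lim = lim_near[of b, OF near(2)]
    have "t i \<le> \<phi> i t"
      using LIMSEQ_le[OF fun_tendstoD[OF a_lim] lim_\<phi>[OF a_lim ab(1)]] ineq(1) by blast
    moreover have "\<phi> i t \<le> t i"
      using LIMSEQ_le[OF lim_\<phi>[OF b_lim ab(2)] fun_tendstoD[OF b_lim]] ineq(2) by blast
    ultimately show ?thesis
      by simp
  qed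
  then show ?thesis
    using t by blast
qed

section \<open>Open covers of a convex set\<close>

lemma continuous_on_scaleR_const:
  fixes c :: "'b::topological_space \<Rightarrow> real" and y :: "'a::real_topological_vector_space"
  assumes "continuous_on S c"
  shows "continuous_on S (\<lambda>t. c t *\<^sub>R y)"
  unfolding continuous_on_def
proof
  fix t assume "t \<in> S"
  then have "filterlim (\<lambda>t. (c t, y)) (nhds (c t) \<times>\<^sub>F nhds y) (at t within S)"
    using assms by (intro filterlim_Pair tendsto_const) (simp add: continuous_on_def)
  from filterlim_compose[OF tendsto_scaleR_Pair this]
  show "((\<lambda>t. c t *\<^sub>R y) \<longlongrightarrow> c t *\<^sub>R y) (at t within S)"
    by simp
qed

text \<open>A retraction of the cube onto the standard simplex. The defect \<open>1 - s\<close> of a coordinate sum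
  \<open>s < 1\<close> is spread evenly, because plain normalisation \<open>t i / s\<close> fails at the origin.\<close>

lemma simplex_retraction:
  assumes "0 < n"
  obtains w :: "nat \<Rightarrow> (nat \<Rightarrow> real) \<Rightarrow> real"
  where "\<And>i. continuous_on unit_cube (w i)"
    and "\<And>i t. t \<in> unit_cube \<Longrightarrow> 0 \<le> w i t"
    and "\<And>t. (\<Sum>i<n. w i t) = 1"
    and "\<And>i t. sum t {..<n} = 1 \<Longrightarrow> w i t = t i"
proof -
  define w where
    "w i t = (t i + max 0 (1 - sum t {..<n}) / real n) / max 1 (sum t {..<n})"
    for i and t :: "nat \<Rightarrow> real"
  show thesis
  proof (rule that[of w])
    show "continuous_on unit_cube (w i)" for i
      unfolding w_def using \<open>0 < n\<close> by (intro continuous_intros continuous_on_coordinate) auto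
    show "0 \<le> w i t" if "t \<in> unit_cube" for i t
      using that by (auto simp: w_def unit_cube_def intro!: divide_nonneg_nonneg add_nonneg_nonneg)
    show "(\<Sum>i<n. w i t) = 1" for t
    proof -
      have "(\<Sum>i<n. w i t) = (sum t {..<n} + max 0 (1 - sum t {..<n})) / max 1 (sum t {..<n})"
        using \<open>0 < n\<close> by (simp add: w_def sum.distrib flip: sum_divide_distrib)
      also have "\<dots> = 1"
        by (auto simp: max_def)
      finally show ?thesis .
    qed
    show "w i t = t i" if "sum t {..<n} = 1" for i t
      using that by (simp add: w_def)
  qed
qed

lemma finite_partition_of_unity:
  fixes Q :: "'a::metric_space set" and V :: "nat \<Rightarrow> 'a set"
  assumes opn: "\<And>i. i < n \<Longrightarrow> openin (top_of_set Q) (V i)" and cov: "Q \<subseteq> (\<Union>i<n. V i)"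
  obtains \<phi> :: "nat \<Rightarrow> 'a \<Rightarrow> real"
    where "\<And>i. i < n \<Longrightarrow> continuous_on Q (\<phi> i)"
      and "\<And>i t. i < n \<Longrightarrow> t \<in> Q \<Longrightarrow> 0 \<le> \<phi> i t"
      and "\<And>i t. i < n \<Longrightarrow> t \<in> Q \<Longrightarrow> 0 < \<phi> i t \<Longrightarrow> t \<in> V i"
      and "\<And>t. t \<in> Q \<Longrightarrow> (\<Sum>i<n. \<phi> i t) = 1"
proof -
  \<comment> \<open>The case distinction is needed because the distance to the empty set is \<open>0\<close> by convention.\<close>
  define d where "d i t = (if Q \<subseteq> V i then 1 else infdist t (Q - V i))" for i t
  have d_cont: "continuous_on Q (d i)" for i
    by (cases "Q \<subseteq> V i") (auto simp: d_def intro!: continuous_intros)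
  have d_nonneg: "0 \<le> d i t" for i t
    by (simp add: d_def infdist_nonneg)
  have d_outside: "d i t = 0" if "t \<in> Q" "t \<notin> V i" for i t
    using that by (auto simp: d_def)
  have d_pos: "0 < d i t" if "i < n" "t \<in> V i" for i t
  proof (cases "Q \<subseteq> V i")
    case False
    obtain T where "open T" and T: "V i = Q \<inter> T"
      using opn[OF \<open>i < n\<close>] by (auto simp: openin_open)
    have "t \<notin> closure (Q - V i)"
      using \<open>t \<in> V i\<close> \<open>open T\<close> by (auto simp: closure_iff_nhds_not_empty T)
    then show ?thesis
      using False in_closure_iff_infdist_zero[of "Q - V i" t] infdist_nonneg[of t "Q - V i"]
      by (auto simp: d_def less_le)
  qed (simp add: d_def)
  have sum_pos: "0 < (\<Sum>i<n. d i t)" if "t \<in> Q" for t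
  proof -
    obtain i where "i < n" "t \<in> V i"
      using cov \<open>t \<in> Q\<close> by auto
    then show ?thesis
      by (intro sum_pos2[of _ i]) (auto intro: d_pos d_nonneg)
  qed
  show thesis
  proof (rule that[of "\<lambda>i t. d i t / (\<Sum>j<n. d j t)"])
    show "continuous_on Q (\<lambda>t. d i t / (\<Sum>j<n. d j t))" for i
      using sum_pos by (intro continuous_intros d_cont) fastforce
    show "0 \<le> d i t / (\<Sum>j<n. d j t)" for i t
      by (simp add: d_nonneg sum_nonneg)
    show "t \<in> V i" if "t \<in> Q" "0 < d i t / (\<Sum>j<n. d j t)" for i t
      using that d_outside by fastforce
    show "(\<Sum>i<n. d i t / (\<Sum>j<n. d j t)) = 1" if "t \<in> Q" for t
      using sum_pos[OF that] by (simp flip: sum_divide_distrib)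
  qed
qed

text \<open>The weights sought are a fixed point of the composition of three maps: the retraction of the
  cube onto the simplex, the map from weights to convex combinations, and a partition of unity
  subordinate to the cover. The values of the partition of unity have sum \<open>1\<close>, hence a fixed point
  lies in the simplex, where the retraction is the identity.\<close>

proposition convex_combination_in_cover:
  fixes X :: "'a::real_topological_vector_space set"
  assumes "convex X" and y: "\<And>i. i < n \<Longrightarrow> y i \<in> X" and "X \<noteq> {}"
    and opn: "\<And>i. i < n \<Longrightarrow> openin (top_of_set X) (U i)" and cov: "X \<subseteq> (\<Union>i<n. U i)"
  shows "\<exists>a::nat \<Rightarrow> real. (\<forall>i<n. 0 \<le> a i) \<and> sum a {..<n} = 1 \<and>
    (\<forall>i<n. 0 < a i \<longrightarrow> (\<Sum>j<n. a j *\<^sub>R y j) \<in> U i)"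
proof -
  have "0 < n"
    using \<open>X \<noteq> {}\<close> cov by (cases n) auto
  obtain w :: "nat \<Rightarrow> (nat \<Rightarrow> real) \<Rightarrow> real" where w_cont: "\<And>i. continuous_on unit_cube (w i)"
    and w_nonneg: "\<And>i t. t \<in> unit_cube \<Longrightarrow> 0 \<le> w i t"
    and w_sum: "\<And>t. (\<Sum>i<n. w i t) = 1"
    and w_id: "\<And>i t. sum t {..<n} = 1 \<Longrightarrow> w i t = t i"
    using simplex_retraction[OF \<open>0 < n\<close>] by blast
  define h where "h t = (\<Sum>i<n. w i t *\<^sub>R y i)" for t
  have h_cont: "continuous_on unit_cube h"
    unfolding h_def by (intro continuous_on_sum continuous_on_scaleR_const w_cont)
  have h_X: "h t \<in> X" if "t \<in> unit_cube" for t
    unfolding h_def using \<open>convex X\<close> y w_nonneg[OF that] w_sum by (intro convex_sum) auto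
  define V where "V i = unit_cube \<inter> h -` U i" for i
  have V_opn: "openin (top_of_set unit_cube) (V i)" if "i < n" for i
    unfolding V_def using continuous_openin_preimage[OF h_cont _ opn[OF that]] h_X by auto
  have V_cov: "unit_cube \<subseteq> (\<Union>i<n. V i)"
    using h_X cov by (fastforce simp: V_def)
  obtain \<phi> where \<phi>_cont: "\<And>i. i < n \<Longrightarrow> continuous_on unit_cube (\<phi> i)"
    and \<phi>_nonneg: "\<And>i t. i < n \<Longrightarrow> t \<in> unit_cube \<Longrightarrow> (0::real) \<le> \<phi> i t"
    and \<phi>_V: "\<And>i t. i < n \<Longrightarrow> t \<in> unit_cube \<Longrightarrow> 0 < \<phi> i t \<Longrightarrow> t \<in> V i"
    and \<phi>_sum: "\<And>t. t \<in> unit_cube \<Longrightarrow> (\<Sum>i<n. \<phi> i t) = 1"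
    using finite_partition_of_unity[OF V_opn V_cov] by blast
  have \<phi>_le: "\<phi> i t \<le> 1" if "i < n" "t \<in> unit_cube" for i t
    using member_le_sum[of i "{..<n}" "\<lambda>i. \<phi> i t"] that \<phi>_nonneg \<phi>_sum by auto
  obtain t where t: "t \<in> unit_cube" and fix_t: "\<And>i. i < n \<Longrightarrow> \<phi> i t = t i"
    using unit_cube_fixed_point[of n \<phi>] \<phi>_cont \<phi>_nonneg \<phi>_le by auto
  have t_sum: "sum t {..<n} = 1"
    using \<phi>_sum[OF t] fix_t by simp
  then have "h t = (\<Sum>j<n. t j *\<^sub>R y j)"
    by (simp add: h_def w_id)
  then have "(\<Sum>j<n. t j *\<^sub>R y j) \<in> U i" if "i < n" "0 < t i" for i
    using \<phi>_V[of i t] that t fix_t by (auto simp: V_def)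
  then show ?thesis
    using t_sum \<phi>_nonneg t fix_t by (metis (no_types, lifting))
qed

section \<open>The minimax inequality\<close>

text \<open>Quasi-concavity passes a lower bound from the points with positive weight to their convex
  combination. The smallest of the finitely many values is such a bound, and it is still
  positive.\<close>

lemma quasi_concave_on_convex_combination_pos:
  fixes a :: "'i \<Rightarrow> real"
  assumes "quasi_concave_on X h" and "finite I"
    and a: "\<And>i. i \<in> I \<Longrightarrow> 0 \<le> a i" "sum a I = 1"
    and y: "\<And>i. i \<in> I \<Longrightarrow> y i \<in> X"
    and pos: "\<And>i. i \<in> I \<Longrightarrow> 0 < a i \<Longrightarrow> 0 < h (y i)"
  shows "0 < h (\<Sum>i\<in>I. a i *\<^sub>R y i)"
proof -
  define J where "J = {i \<in> I. 0 < a i}"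
  have J: "finite J" "J \<subseteq> I"
    using \<open>finite I\<close> by (auto simp: J_def)
  have zero: "a i = 0" if "i \<in> I - J" for i
    using that a(1) by (force simp: J_def)
  have J_sum: "sum a J = 1"
    using sum.mono_neutral_left[OF \<open>finite I\<close> J(2), of a] zero a(2) by simp
  have J_comb: "(\<Sum>i\<in>I. a i *\<^sub>R y i) = (\<Sum>i\<in>J. a i *\<^sub>R y i)"
    using sum.mono_neutral_right[OF \<open>finite I\<close> J(2), of "\<lambda>i. a i *\<^sub>R y i"] zero by simp
  have "J \<noteq> {}"
    using J_sum by auto
  define c where "c = Min ((\<lambda>i. h (y i)) ` J)"
  have "0 < c"
    using J(1) \<open>J \<noteq> {}\<close> pos by (auto simp: c_def J_def)
  have "y i \<in> {x \<in> X. c \<le> h x}" if "i \<in> J" for i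
    using that J y by (auto simp: c_def)
  moreover have "convex {x \<in> X. c \<le> h x}"
    using assms(1) by (simp add: quasi_concave_on_def)
  ultimately have "(\<Sum>i\<in>J. a i *\<^sub>R y i) \<in> {x \<in> X. c \<le> h x}"
    using J_sum J a(1) by (intro convex_sum) auto
  then show ?thesis
    using \<open>0 < c\<close> J_comb by simp
qed

theorem theorem4p6:
  fixes X :: "'a::{real_topological_vector_space, t2_space} set"
    and f g :: "'a \<Rightarrow> 'a \<Rightarrow> real"
  assumes "X \<noteq> {}" and "compact X" and "convex X"
    and "\<And>x y. x \<in> X \<Longrightarrow> y \<in> X \<Longrightarrow> f x y \<le> g x y"
    and "\<And>y. y \<in> X \<Longrightarrow> lower_semicontinuous_on X (\<lambda>x. f x y)"
    and "\<And>x. x \<in> X \<Longrightarrow> quasi_concave_on X (\<lambda>y. g x y)"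
    and "\<And>x. x \<in> X \<Longrightarrow> g x x \<le> 0"
  shows "\<exists>x0\<in>X. \<forall>y\<in>X. f x0 y \<le> 0"
proof (rule ccontr)
  assume no_point: "\<not> ?thesis"
  define U where "U y = {x \<in> X. 0 < f x y}" for y
  have U_opn: "openin (top_of_set X) (U y)" if "y \<in> X" for y
    using assms(5)[OF that] by (simp add: U_def lower_semicontinuous_on_def)
  have "X \<subseteq> \<Union> (U ` X)"
    using no_point by (force simp: U_def not_le)
  then obtain \<D> where "\<D> \<subseteq> U ` X" "finite \<D>" "X \<subseteq> \<Union>\<D>"
    using \<open>compact X\<close> U_opn unfolding compact_eq_openin_cover by (metis (no_types, lifting) imageE)
  then obtain D where D: "D \<subseteq> X" "finite D" "X \<subseteq> \<Union> (U ` D)"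
    using finite_subset_image by metis
  obtain y :: "nat \<Rightarrow> 'a" and n where D_eq: "D = y ` {..<n}"
    using finite_imp_nat_seg_image_inj_on[OF D(2)] by (auto simp: lessThan_def)
  have y_X: "y i \<in> X" if "i < n" for i
    using D(1) D_eq that by blast
  have cov: "X \<subseteq> (\<Union>i<n. U (y i))"
    using D(3) by (simp add: D_eq image_image)
  obtain a :: "nat \<Rightarrow> real" where a: "\<And>i. i < n \<Longrightarrow> 0 \<le> a i" "sum a {..<n} = 1"
    and a_U: "\<And>i. i < n \<Longrightarrow> 0 < a i \<Longrightarrow> (\<Sum>j<n. a j *\<^sub>R y j) \<in> U (y i)"
    using convex_combination_in_cover[of X n y "\<lambda>i. U (y i)"] \<open>convex X\<close> y_X \<open>X \<noteq> {}\<close> U_opn cov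
    by auto
  define x where "x = (\<Sum>j<n. a j *\<^sub>R y j)"
  have x: "x \<in> X"
    unfolding x_def using \<open>convex X\<close> a y_X by (intro convex_sum) auto
  have "0 < g x (y i)" if "i < n" "0 < a i" for i
    using a_U[OF that] assms(4)[OF x y_X[OF that(1)]] by (simp add: U_def flip: x_def)
  then have "0 < g x x"
    using quasi_concave_on_convex_combination_pos[OF assms(6)[OF x], of "{..<n}" a y] a y_X
    by (simp flip: x_def)
  then show False
    using assms(7)[OF x] by simp
qed

end
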